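(* A displacement field $\mathbf{u}:\Omega\to\mathbb{R}^3$ is universal for the orthotropic class $\mathbb{D}_2\oplus\mathbb{Z}_2^c$ of linear strain-gradient elastic solids if and only if it is the superposition (sum) of a homogeneous displacement field and a field $(\alpha_1x_2x_3,\,\alpha_2x_1x_3,\,\alpha_3x_1x_2)$ for some constants $\alpha_1,\alpha_2,\alpha_3\in\mathbb{R}$.
   Context: $\Omega\subset\mathbb{R}^3$ is a nonempty convex open set with Cartesian coordinates $(x_1,x_2,x_3)$ and orthonormal basis $e_1,e_2,e_3$. Repeated indices are summed over $1,2,3$ and a comma denotes partial differentiation. A displacement field is a smooth map $\mathbf{u}:\Omega\to\mathbb{R}^3$, with strain $e_{lm}=\tfrac12(u_{l,m}+u_{m,l})$. It is homogeneous if $\mathbf{u}(\mathbf{x})=\mathbf{H}\mathbf{x}+\mathbf{b}$ for a constant matrix $\mathbf{H}$ and constant vector $\mathbf{b}$. A strain-gradient material is a triple $(\mathsf{C},\mathsf{M},\mathsf{A})$ of constant real tensors of orders $4,5,6$ with index symmetries $\mathsf{C}_{ijlm}=\mathsf{C}_{jilm}=\mathsf{C}_{lmij}$, $\mathsf{M}_{ijklm}=\mathsf{M}_{jiklm}=\mathsf{M}_{ijlkm}$, $\mathsf{A}_{ijklmn}=\mathsf{A}_{jiklmn}=\mathsf{A}_{lmnijk}$. Its stress and hyper-stress are $\sigma_{ij}=\mathsf{C}_{ijlm}e_{lm}+\mathsf{M}_{ijlmn}e_{lm,n}$ and $\tau_{ijk}=\mathsf{M}_{lmijk}e_{lm}+\mathsf{A}_{ijklmn}e_{lm,n}$,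 and the equilibrium equations without body forces are $\sigma_{ij,j}-\tau_{ijk,jk}=0$ in $\Omega$ for $i=1,2,3$. For a subgroup $G\subset \mathrm{O}(3)$, a tensor $T$ of order $p$ is $G$-invariant if $Q_{i_1j_1}\cdots Q_{i_pj_p}T_{j_1\dots j_p}=T_{i_1\dots i_p}$ for all $Q\in G$. $\mathbb{D}_2$ is the group generated by the rotations by $\pi$ about $e_3$ and about $e_1$; $\mathbb{Z}_2^c=\{I,-I\}$, and $\mathbb{D}_2\oplus\mathbb{Z}_2^c$ is the group generated by $\mathbb{D}_2$ and $-I$. The orthotropic class $\mathbb{D}_2\oplus\mathbb{Z}_2^c$ is the set of all materials with $\mathsf{C}$ and $\mathsf{A}$ $\mathbb{D}_2\oplus\mathbb{Z}_2^c$-invariant (9 and 51 independent constants) and $\mathsf{M}=0$. A displacement field is universal for the class if it satisfies the equilibrium equations for every material in the class. *)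

theory Defs
  imports "HOL-Analysis.Analysis" "HOL-Algebra.Generated_Groups"
begin

text \<open>Coordinates are indexed by the type \<^typ>\<open>3\<close>, whose elements are \<open>1\<close>, \<open>2\<close>, \<open>3\<close>
  (with \<open>3 = 0\<close>), and \<open>axis i 1\<close> is the basis vector \<open>e\<^sub>i\<close>.  Fields on an open set \<open>\<Omega>\<close> are total
  functions of which only the values on \<open>\<Omega>\<close> matter.\<close>

definition pd :: "3 \<Rightarrow> (real^3 \<Rightarrow> real) \<Rightarrow> real^3 \<Rightarrow> real" where
  "pd j f x = deriv (\<lambda>t. f (x + t *\<^sub>R axis j 1)) 0"

text \<open>On an open set this is membership in \<open>C\<^sup>\<infinity>\<close>: the iterated partial derivatives of all orders
  (the empty list of indices gives \<open>f\<close> itself) exist and, being differentiable, are continuous.\<close>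

definition smooth_on :: "(real^3) set \<Rightarrow> (real^3 \<Rightarrow> real) \<Rightarrow> bool" where
  "smooth_on \<Omega> f \<longleftrightarrow> (\<forall>js. foldr pd js f differentiable_on \<Omega>)"

definition displacement_field :: "(real^3) set \<Rightarrow> (real^3 \<Rightarrow> real^3) \<Rightarrow> bool" where
  "displacement_field \<Omega> u \<longleftrightarrow> (\<forall>i. smooth_on \<Omega> (\<lambda>x. u x $ i))"

definition homogeneous :: "(real^3) set \<Rightarrow> (real^3 \<Rightarrow> real^3) \<Rightarrow> bool" where
  "homogeneous \<Omega> u \<longleftrightarrow> (\<exists>(H :: real^3^3) b. \<forall>x\<in>\<Omega>. u x = H *v x + b)"

definition strain :: "(real^3 \<Rightarrow> real^3) \<Rightarrow> 3 \<Rightarrow> 3 \<Rightarrow> real^3 \<Rightarrow> real" where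
  "strain u l m x = 1/2 * (pd m (\<lambda>y. u y $ l) x + pd l (\<lambda>y. u y $ m) x)"

type_synonym tensor4 = "3 \<Rightarrow> 3 \<Rightarrow> 3 \<Rightarrow> 3 \<Rightarrow> real"
type_synonym tensor5 = "3 \<Rightarrow> 3 \<Rightarrow> 3 \<Rightarrow> 3 \<Rightarrow> 3 \<Rightarrow> real"
type_synonym tensor6 = "3 \<Rightarrow> 3 \<Rightarrow> 3 \<Rightarrow> 3 \<Rightarrow> 3 \<Rightarrow> 3 \<Rightarrow> real"

definition sg_material :: "tensor4 \<Rightarrow> tensor5 \<Rightarrow> tensor6 \<Rightarrow> bool" where
  "sg_material C M A \<longleftrightarrow>
     (\<forall>i j l m. C i j l m = C j i l m \<and> C i j l m = C l m i j) \<and>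
     (\<forall>i j k l m. M i j k l m = M j i k l m \<and> M i j k l m = M i j l k m) \<and>
     (\<forall>i j k l m n. A i j k l m n = A j i k l m n \<and> A i j k l m n = A l m n i j k)"

definition stress ::
  "tensor4 \<Rightarrow> tensor5 \<Rightarrow> (real^3 \<Rightarrow> real^3) \<Rightarrow> 3 \<Rightarrow> 3 \<Rightarrow> real^3 \<Rightarrow> real" where
  "stress C M u i j x =
     (\<Sum>l\<in>UNIV. \<Sum>m\<in>UNIV. C i j l m * strain u l m x) +
     (\<Sum>l\<in>UNIV. \<Sum>m\<in>UNIV. \<Sum>n\<in>UNIV. M i j l m n * pd n (strain u l m) x)"

definition hyperstress ::
  "tensor5 \<Rightarrow> tensor6 \<Rightarrow> (real^3 \<Rightarrow> real^3) \<Rightarrow> 3 \<Rightarrow> 3 \<Rightarrow> 3 \<Rightarrow> real^3 \<Rightarrow> real" where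
  "hyperstress M A u i j k x =
     (\<Sum>l\<in>UNIV. \<Sum>m\<in>UNIV. M l m i j k * strain u l m x) +
     (\<Sum>l\<in>UNIV. \<Sum>m\<in>UNIV. \<Sum>n\<in>UNIV. A i j k l m n * pd n (strain u l m) x)"

definition equilibrium ::
  "(real^3) set \<Rightarrow> tensor4 \<Rightarrow> tensor5 \<Rightarrow> tensor6 \<Rightarrow> (real^3 \<Rightarrow> real^3) \<Rightarrow> bool" where
  "equilibrium \<Omega> C M A u \<longleftrightarrow>
     (\<forall>x\<in>\<Omega>. \<forall>i.
        (\<Sum>j\<in>UNIV. pd j (stress C M u i j) x) -
        (\<Sum>j\<in>UNIV. \<Sum>k\<in>UNIV. pd k (pd j (hyperstress M A u i j k)) x) = 0)"

definition O3 :: "(real^3^3) monoid" where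
  "O3 = \<lparr>carrier = {Q. orthogonal_matrix Q}, mult = (**), one = mat 1\<rparr>"

text \<open>Rodrigues' formula for the rotation by the angle \<open>\<theta>\<close> about the unit vector \<open>a\<close>.\<close>

definition rotation_about :: "real^3 \<Rightarrow> real \<Rightarrow> real^3^3" where
  "rotation_about a \<theta> =
     matrix (\<lambda>x. cos \<theta> *\<^sub>R x + sin \<theta> *\<^sub>R cross3 a x + ((1 - cos \<theta>) * (a \<bullet> x)) *\<^sub>R a)"

definition D2 :: "(real^3^3) set" where
  "D2 = generate O3 {rotation_about (axis 3 1) pi, rotation_about (axis 1 1) pi}"

definition D2_Z2c :: "(real^3^3) set" where
  "D2_Z2c = generate O3 (D2 \<union> {- mat 1})"

definition invariant4 :: "(real^3^3) set \<Rightarrow> tensor4 \<Rightarrow> bool" where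
  "invariant4 G T \<longleftrightarrow> (\<forall>Q\<in>G. \<forall>i\<^sub>1 i\<^sub>2 i\<^sub>3 i\<^sub>4.
     (\<Sum>j\<^sub>1\<in>UNIV. \<Sum>j\<^sub>2\<in>UNIV. \<Sum>j\<^sub>3\<in>UNIV. \<Sum>j\<^sub>4\<in>UNIV.
        Q$i\<^sub>1$j\<^sub>1 * Q$i\<^sub>2$j\<^sub>2 * Q$i\<^sub>3$j\<^sub>3 * Q$i\<^sub>4$j\<^sub>4 * T j\<^sub>1 j\<^sub>2 j\<^sub>3 j\<^sub>4) = T i\<^sub>1 i\<^sub>2 i\<^sub>3 i\<^sub>4)"

definition invariant6 :: "(real^3^3) set \<Rightarrow> tensor6 \<Rightarrow> bool" where
  "invariant6 G T \<longleftrightarrow> (\<forall>Q\<in>G. \<forall>i\<^sub>1 i\<^sub>2 i\<^sub>3 i\<^sub>4 i\<^sub>5 i\<^sub>6.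
     (\<Sum>j\<^sub>1\<in>UNIV. \<Sum>j\<^sub>2\<in>UNIV. \<Sum>j\<^sub>3\<in>UNIV. \<Sum>j\<^sub>4\<in>UNIV. \<Sum>j\<^sub>5\<in>UNIV. \<Sum>j\<^sub>6\<in>UNIV.
        Q$i\<^sub>1$j\<^sub>1 * Q$i\<^sub>2$j\<^sub>2 * Q$i\<^sub>3$j\<^sub>3 * Q$i\<^sub>4$j\<^sub>4 * Q$i\<^sub>5$j\<^sub>5 * Q$i\<^sub>6$j\<^sub>6 * T j\<^sub>1 j\<^sub>2 j\<^sub>3 j\<^sub>4 j\<^sub>5 j\<^sub>6)
      = T i\<^sub>1 i\<^sub>2 i\<^sub>3 i\<^sub>4 i\<^sub>5 i\<^sub>6)"

definition orthotropic_class :: "(tensor4 \<times> tensor5 \<times> tensor6) set" where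
  "orthotropic_class =
     {(C, M, A). sg_material C M A \<and> invariant4 D2_Z2c C \<and> invariant6 D2_Z2c A \<and>
        (\<forall>i j k l m. M i j k l m = 0)}"

definition universal ::
  "(real^3) set \<Rightarrow> (tensor4 \<times> tensor5 \<times> tensor6) set \<Rightarrow> (real^3 \<Rightarrow> real^3) \<Rightarrow> bool" where
  "universal \<Omega> \<M> u \<longleftrightarrow> (\<forall>(C, M, A)\<in>\<M>. equilibrium \<Omega> C M A u)"

end

theory Submission
  imports Defs
begin

text \<open>With vanishing sixth-order tensor and a single nonzero orthotropic stiffness, equilibrium gives
  \<open>u\<^bsub>q,qp\<^esub> = 0\<close> for all \<open>p, q\<close> (stiffness \<open>C\<^bsub>ppqq\<^esub>\<close>) and then \<open>u\<^bsub>p,qq\<^esub> = 0\<close> for \<open>p \<noteq> q\<close>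
  (stiffness \<open>C\<^bsub>pqpq\<^esub>\<close>).  The only second derivatives left are \<open>u\<^bsub>p,qr\<^esub>\<close> with \<open>p, q, r\<close> distinct; all
  their derivatives vanish, so they are constant and the components integrate to the stated form.
  Conversely, such a field has constant strain gradient, so the hyper-stress drops out, and
  \<open>e\<^bsub>lm,j\<^esub>\<close> is nonzero only for \<open>j, l, m\<close> distinct, where \<open>C\<^bsub>ijlm\<^esub>\<close> vanishes by invariance under the
  half-turns.\<close>

subsection \<open>Partial derivatives\<close>

text \<open>The chain rule along the line through \<open>x\<close> reduces the one-variable
  \<open>deriv\<close> in \<open>pd\<close> to a total derivative. Concrete partial derivatives are
  read off from it below.\<close>

lemma pd_has_derivative:
  assumes "(f has_derivative f') (at x)"
  shows "pd j f x = f' (axis j 1)"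
proof -
  have "((\<lambda>t. x + t *\<^sub>R axis j 1) has_derivative (\<lambda>t. t *\<^sub>R axis j 1)) (at (0::real))"
    by (auto intro!: derivative_eq_intros)
  from has_derivative_compose[OF this, of f f'] assms
  have "((\<lambda>t. f (x + t *\<^sub>R axis j 1)) has_derivative (\<lambda>t. f' (t *\<^sub>R axis j 1))) (at 0)"
    by simp
  moreover have "(\<lambda>t. f' (t *\<^sub>R axis j 1)) = (*) (f' (axis j 1))"
    using linear_scale[OF has_derivative_linear[OF assms]] by (auto simp: mult.commute)
  ultimately have "((\<lambda>t. f (x + t *\<^sub>R axis j 1)) has_real_derivative f' (axis j 1)) (at 0)"
    by (simp add: has_field_derivative_def)
  then show ?thesis
    unfolding pd_def by (rule DERIV_imp_deriv)
qed

text \<open>The derivative is linear, hence fixed by its values on the basis vectors, which are the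
  partial derivatives.\<close>

lemma has_derivative_pd:
  assumes "f differentiable (at x)"
  shows "(f has_derivative (\<lambda>h. \<Sum>j\<in>UNIV. h $ j * pd j f x)) (at x)"
proof -
  obtain f' where f': "(f has_derivative f') (at x)"
    using assms by (auto simp: differentiable_def)
  have lin: "linear f'"
    using f' by (rule has_derivative_linear)
  have "f' h = (\<Sum>j\<in>UNIV. h $ j * pd j f x)" for h
  proof -
    have "f' h = f' (\<Sum>j\<in>UNIV. h $ j *\<^sub>R axis j 1)"
      by (metis (mono_tags, lifting) basis_expansion scalar_mult_eq_scaleR sum.cong)
    then show ?thesis
      by (simp add: linear_sum[OF lin] linear_scale[OF lin] pd_has_derivative[OF f'])
  qed
  then show ?thesis
    using f' by presburger
qed

lemma DERIV_along_axis:
  assumes "f differentiable (at (x + t *\<^sub>R axis j 1))"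
  shows "((\<lambda>t. f (x + t *\<^sub>R axis j 1)) has_real_derivative pd j f (x + t *\<^sub>R axis j 1)) (at t)"
proof -
  let ?y = "x + t *\<^sub>R axis j 1"
  obtain f' where f': "(f has_derivative f') (at ?y)"
    using assms by (auto simp: differentiable_def)
  have "((\<lambda>t. x + t *\<^sub>R axis j 1) has_derivative (\<lambda>t. t *\<^sub>R axis j 1)) (at t)"
    by (auto intro!: derivative_eq_intros)
  from has_derivative_compose[OF this f']
  have "((\<lambda>t. f (x + t *\<^sub>R axis j 1)) has_derivative (\<lambda>t. f' (t *\<^sub>R axis j 1))) (at t)" .
  moreover have "(\<lambda>t. f' (t *\<^sub>R axis j 1)) = (*) (pd j f ?y)"
    using linear_scale[OF has_derivative_linear[OF f']]
    by (auto simp: mult.commute pd_has_derivative[OF f'])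
  ultimately show ?thesis
    by (simp add: has_field_derivative_def)
qed

text \<open>A short segment through \<open>x\<close> stays in the open set, and \<open>deriv\<close>
  depends only on values near 0. This allows identities known only on \<Omega> to be differentiated
  again.\<close>

lemma pd_cong:
  assumes "open \<Omega>" "x \<in> \<Omega>" "\<And>y. y \<in> \<Omega> \<Longrightarrow> f y = g y"
  shows "pd j f x = pd j g x"
proof -
  have "((\<lambda>t. x + t *\<^sub>R axis j 1) \<longlongrightarrow> x + 0 *\<^sub>R axis j 1) (nhds (0::real))"
    by (intro tendsto_intros filterlim_ident)
  then have "\<forall>\<^sub>F t in nhds (0::real). x + t *\<^sub>R axis j 1 \<in> \<Omega>"
    using topological_tendstoD[OF _ assms(1)] assms(2) by fastforce
  then have "\<forall>\<^sub>F t in nhds (0::real). f (x + t *\<^sub>R axis j 1) = g (x + t *\<^sub>R axis j 1)"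
    by eventually_elim (rule assms(3))
  then show ?thesis
    unfolding pd_def by (intro deriv_cong_ev) auto
qed

lemma pd_linear_combination:
  assumes "finite I" "\<And>k. k \<in> I \<Longrightarrow> g k differentiable (at x)"
  shows "pd j (\<lambda>x. \<Sum>k\<in>I. c k * g k x) x = (\<Sum>k\<in>I. c k * pd j (g k) x)"
proof -
  have "((\<lambda>x. \<Sum>k\<in>I. c k * g k x) has_derivative
      (\<lambda>h. \<Sum>k\<in>I. c k * (\<Sum>j\<in>UNIV. h $ j * pd j (g k) x))) (at x)"
    by (intro derivative_intros has_derivative_pd assms)
  from pd_has_derivative[OF this] show ?thesis
    by (simp add: axis_def if_distrib[where f="\<lambda>a. a * _"] cong: if_cong)
qed

text \<open>Subtracting the linear form leaves a function with zero derivative, which is constant on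
  a convex set. Every integration below goes through this lemma; \<open>a = 0\<close> gives
  constancy.\<close>

lemma affine_if_pd_constant:
  assumes \<Omega>: "open \<Omega>" "convex \<Omega>"
    and f: "f differentiable_on \<Omega>"
    and pd: "\<And>j x. x \<in> \<Omega> \<Longrightarrow> pd j f x = a j"
  obtains d where "\<And>x. x \<in> \<Omega> \<Longrightarrow> f x = d + (\<Sum>j\<in>UNIV. a j * x $ j)"
proof -
  let ?g = "\<lambda>x. f x - (\<Sum>j\<in>UNIV. a j * x $ j)"
  have "(?g has_derivative (\<lambda>h. 0)) (at x within \<Omega>)" if "x \<in> \<Omega>" for x
  proof -
    have "f differentiable (at x)"
      using f that \<Omega>(1) by (simp add: differentiable_on_eq_differentiable_at)
    from has_derivative_at_withinI[OF has_derivative_pd[OF this]]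
    have "(f has_derivative (\<lambda>h. \<Sum>j\<in>UNIV. a j * h $ j)) (at x within \<Omega>)"
      by (simp add: pd[OF that] mult.commute)
    moreover have "((\<lambda>x. \<Sum>j\<in>UNIV. a j * x $ j) has_derivative (\<lambda>h. \<Sum>j\<in>UNIV. a j * h $ j))
        (at x within \<Omega>)"
      by (intro has_derivative_sum has_derivative_mult_right bounded_linear_imp_has_derivative
          bounded_linear_vec_nth)
    ultimately show ?thesis
      by (rule has_derivative_diff[THEN has_derivative_eq_rhs]) simp
  qed
  from has_derivative_zero_constant[OF \<Omega>(2) this]
  obtain d where "\<forall>x\<in>\<Omega>. ?g x = d" by auto
  then show thesis by (intro that[of d]) force
qed

section \<open>Smooth functions and the symmetry of their second derivatives\<close>

lemma smooth_on_pd: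
  assumes "smooth_on \<Omega> f"
  shows "smooth_on \<Omega> (pd j f)"
  unfolding smooth_on_def
proof
  fix js
  \<comment> \<open>\<open>foldr\<close> applies the last index of the list first, so appending
    \<open>j\<close> differentiates by \<open>j\<close> before \<open>js\<close>.\<close>
  have "foldr pd (js @ [j]) f differentiable_on \<Omega>"
    using assms unfolding smooth_on_def by blast
  then show "foldr pd js (pd j f) differentiable_on \<Omega>"
    by simp
qed

lemma smooth_on_imp_differentiable_on:
  assumes "smooth_on \<Omega> f"
  shows "f differentiable_on \<Omega>"
proof -
  have "foldr pd [] f differentiable_on \<Omega>"
    using assms unfolding smooth_on_def by blast
  then show ?thesis by simp
qed

lemma smooth_on_differentiable:
  assumes "smooth_on \<Omega> f" "open \<Omega>" "x \<in> \<Omega>"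
  shows "f differentiable (at x)"
  using smooth_on_imp_differentiable_on[OF assms(1)] assms(2,3)
  by (simp add: differentiable_on_eq_differentiable_at)

text \<open>The second difference over a square of side \<open>\<delta>\<close> is evaluated by two applications of the mean
  value theorem; its symmetry in \<open>a\<close> and \<open>b\<close> yields the symmetry of second derivatives.\<close>

lemma second_difference_mean_value:
  fixes x :: "real^3"
  assumes f: "\<And>y. y \<in> ball x (3 * \<delta>) \<Longrightarrow> f differentiable (at y)"
    and f': "\<And>y. y \<in> ball x (3 * \<delta>) \<Longrightarrow> pd a f differentiable (at y)"
    and \<delta>: "0 < \<delta>"
  obtains \<xi> where "\<xi> \<in> ball x (3 * \<delta>)"
    "f (x + \<delta> *\<^sub>R axis a 1 + \<delta> *\<^sub>R axis b 1) - f (x + \<delta> *\<^sub>R axis a 1) - f (x + \<delta> *\<^sub>R axis b 1) + f x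
      = \<delta> * \<delta> * pd b (pd a f) \<xi>"
proof -
  \<comment> \<open>Points of the square have distance at most 2\<delta> from \<open>x\<close>; the
    factor 3 makes the bound strict.\<close>
  have in_ball: "x + s *\<^sub>R axis a 1 + t *\<^sub>R axis b 1 \<in> ball x (3 * \<delta>)"
    if "0 \<le> s" "s \<le> \<delta>" "0 \<le> t" "t \<le> \<delta>" for s t
  proof -
    have "norm (s *\<^sub>R axis a (1::real) + t *\<^sub>R axis b 1) \<le> \<bar>s\<bar> + \<bar>t\<bar>"
      using norm_triangle_ineq[of "s *\<^sub>R axis a (1::real)" "t *\<^sub>R axis b 1"] by simp
    moreover have "dist x (x + s *\<^sub>R axis a 1 + t *\<^sub>R axis b 1)
        = norm (s *\<^sub>R axis a (1::real) + t *\<^sub>R axis b 1)"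
      by (metis add.assoc add_diff_cancel_left' dist_commute dist_norm)
    ultimately show ?thesis
      using that \<delta> by simp
  qed
  \<comment> \<open>The increment in direction \<open>b\<close>, as a function of the position along
    \<open>a\<close>; its own increment is the second difference.\<close>
  let ?g = "\<lambda>s. f (x + \<delta> *\<^sub>R axis b 1 + s *\<^sub>R axis a 1) - f (x + s *\<^sub>R axis a 1)"
  have "\<exists>s. 0 < s \<and> s < \<delta> \<and> ?g \<delta> - ?g 0
      = (\<delta> - 0) * (pd a f (x + \<delta> *\<^sub>R axis b 1 + s *\<^sub>R axis a 1) - pd a f (x + s *\<^sub>R axis a 1))"
  proof (rule MVT2[OF \<delta>])
    fix s assume "0 \<le> s" "s \<le> \<delta>"
    then show "(?g has_real_derivative
        pd a f (x + \<delta> *\<^sub>R axis b 1 + s *\<^sub>R axis a 1) - pd a f (x + s *\<^sub>R axis a 1)) (at s)"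
      using in_ball[of s \<delta>] in_ball[of s 0] \<delta>
      by (intro DERIV_diff DERIV_along_axis f) (auto simp: algebra_simps)
  qed
  then obtain s where s: "0 < s" "s < \<delta>" and gs: "?g \<delta> - ?g 0
      = \<delta> * (pd a f (x + \<delta> *\<^sub>R axis b 1 + s *\<^sub>R axis a 1) - pd a f (x + s *\<^sub>R axis a 1))"
    by auto
  let ?h = "\<lambda>t. pd a f (x + s *\<^sub>R axis a 1 + t *\<^sub>R axis b 1)"
  have "\<exists>t. 0 < t \<and> t < \<delta> \<and> ?h \<delta> - ?h 0
      = (\<delta> - 0) * pd b (pd a f) (x + s *\<^sub>R axis a 1 + t *\<^sub>R axis b 1)"
    using s by (intro MVT2[OF \<delta>] DERIV_along_axis f' in_ball) auto
  then obtain t where t: "0 < t" "t < \<delta>" and ht: "?h \<delta> - ?h 0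
      = \<delta> * pd b (pd a f) (x + s *\<^sub>R axis a 1 + t *\<^sub>R axis b 1)"
    by auto
  show thesis
  proof
    show "x + s *\<^sub>R axis a 1 + t *\<^sub>R axis b 1 \<in> ball x (3 * \<delta>)"
      using s t by (intro in_ball) auto
    show "f (x + \<delta> *\<^sub>R axis a 1 + \<delta> *\<^sub>R axis b 1) - f (x + \<delta> *\<^sub>R axis a 1) - f (x + \<delta> *\<^sub>R axis b 1) + f x
      = \<delta> * \<delta> * pd b (pd a f) (x + s *\<^sub>R axis a 1 + t *\<^sub>R axis b 1)"
      using gs ht by (simp add: add_ac)
  qed
qed

lemma pd_commute:
  assumes \<Omega>: "open \<Omega>" "x \<in> \<Omega>" and f: "smooth_on \<Omega> f"
  shows "pd a (pd b f) x = pd b (pd a f) x"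
proof (rule ccontr)
  assume neq: "pd a (pd b f) x \<noteq> pd b (pd a f) x"
  \<comment> \<open>Half the gap: numbers strictly within \<epsilon> of the two different values
    cannot coincide, but the mean values at \<xi> and \<eta> do.\<close>
  define \<epsilon> where "\<epsilon> = \<bar>pd a (pd b f) x - pd b (pd a f) x\<bar> / 2"
  have "0 < \<epsilon>" using neq by (simp add: \<epsilon>_def)
  have "isCont (pd c (pd d f)) x" for c d
    using \<Omega> f by (intro differentiable_imp_continuous_within smooth_on_differentiable smooth_on_pd)
  then have "\<forall>\<^sub>F y in nhds x. dist (pd c (pd d f) y) (pd c (pd d f) x) < \<epsilon>" for c d
    using \<open>0 < \<epsilon>\<close> by (intro tendstoD) (simp_all add: continuous_at tendsto_at_iff_tendsto_nhds)
  from this[of a b] this[of b a] eventually_nhds_in_open[OF \<Omega>]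
  have "\<forall>\<^sub>F y in nhds x. y \<in> \<Omega> \<and> dist (pd a (pd b f) y) (pd a (pd b f) x) < \<epsilon>
      \<and> dist (pd b (pd a f) y) (pd b (pd a f) x) < \<epsilon>"
    by eventually_elim simp
  then obtain r where r: "0 < r" and near: "\<And>y. dist y x < r \<Longrightarrow> y \<in> \<Omega>
      \<and> dist (pd a (pd b f) y) (pd a (pd b f) x) < \<epsilon> \<and> dist (pd b (pd a f) y) (pd b (pd a f) x) < \<epsilon>"
    unfolding eventually_nhds_metric by blast
  define \<delta> where "\<delta> = r / 3"
  have \<delta>: "0 < \<delta>" "3 * \<delta> = r" using r by (auto simp: \<delta>_def)
  have diff: "f differentiable (at y)" "pd c f differentiable (at y)" if "y \<in> ball x (3 * \<delta>)" for y c
    using that near \<delta> \<Omega>(1) f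
    by (auto intro!: smooth_on_differentiable[of \<Omega>] smooth_on_pd simp: dist_commute)
  obtain \<xi> where \<xi>: "\<xi> \<in> ball x (3 * \<delta>)"
    "f (x + \<delta> *\<^sub>R axis a 1 + \<delta> *\<^sub>R axis b 1) - f (x + \<delta> *\<^sub>R axis a 1) - f (x + \<delta> *\<^sub>R axis b 1) + f x
      = \<delta> * \<delta> * pd b (pd a f) \<xi>"
    using second_difference_mean_value[OF diff \<delta>(1)] by metis
  obtain \<eta> where \<eta>: "\<eta> \<in> ball x (3 * \<delta>)"
    "f (x + \<delta> *\<^sub>R axis b 1 + \<delta> *\<^sub>R axis a 1) - f (x + \<delta> *\<^sub>R axis b 1) - f (x + \<delta> *\<^sub>R axis a 1) + f x
      = \<delta> * \<delta> * pd a (pd b f) \<eta>"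
    using second_difference_mean_value[OF diff \<delta>(1)] by metis
  have "\<delta> * \<delta> * pd b (pd a f) \<xi> = \<delta> * \<delta> * pd a (pd b f) \<eta>"
    using \<xi>(2) \<eta>(2) by (simp add: algebra_simps)
  then have "pd b (pd a f) \<xi> = pd a (pd b f) \<eta>"
    using \<delta> by simp
  moreover have "\<bar>pd b (pd a f) \<xi> - pd b (pd a f) x\<bar> < \<epsilon>" "\<bar>pd a (pd b f) \<eta> - pd a (pd b f) x\<bar> < \<epsilon>"
    using near[of \<xi>] near[of \<eta>] \<xi>(1) \<eta>(1) \<delta>(2) by (auto simp: dist_real_def dist_commute)
  moreover have "\<bar>pd a (pd b f) x - pd b (pd a f) x\<bar> = 2 * \<epsilon>"
    by (simp add: \<epsilon>_def)
  ultimately show False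
    by linarith
qed

subsection \<open>Invariance under \<open>D2_Z2c\<close>\<close>

definition diag :: "(3 \<Rightarrow> real) \<Rightarrow> real^3^3" where
  "diag s = (\<chi> i j. if i = j then s i else 0)"

lemma diag_mult: "diag s ** diag t = diag (\<lambda>i. s i * t i)"
  by (simp add: diag_def matrix_matrix_mult_def vec_eq_iff if_distrib[where f="\<lambda>a. a * _"] cong: if_cong)

lemma diag_one: "diag (\<lambda>i. 1) = mat 1"
  by (simp add: diag_def mat_def)

text \<open>\<open>m_inv\<close> is a definite description, so existence and uniqueness are both
  checked; uniqueness comes from multiplying by \<open>diag s\<close> once more.\<close>

lemma diag_sign_inverse:
  assumes "\<And>i. s i * s i = 1"
  shows "inv\<^bsub>O3\<^esub> diag s = diag s"
  unfolding m_inv_def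
proof (rule the_equality)
  have sq: "diag s ** diag s = mat 1"
    by (simp add: diag_mult assms diag_one)
  have "transpose (diag s) = diag s"
    by (auto simp: transpose_def diag_def vec_eq_iff)
  then show "diag s \<in> carrier O3 \<and> diag s \<otimes>\<^bsub>O3\<^esub> diag s = \<one>\<^bsub>O3\<^esub> \<and> diag s \<otimes>\<^bsub>O3\<^esub> diag s = \<one>\<^bsub>O3\<^esub>"
    using sq by (simp add: O3_def orthogonal_matrix_def)
  fix Q assume "Q \<in> carrier O3 \<and> diag s \<otimes>\<^bsub>O3\<^esub> Q = \<one>\<^bsub>O3\<^esub> \<and> Q \<otimes>\<^bsub>O3\<^esub> diag s = \<one>\<^bsub>O3\<^esub>"
  then have "diag s ** Q = mat 1" by (simp add: O3_def)
  then have "diag s ** (diag s ** Q) = diag s" by simp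
  then show "Q = diag s" by (simp add: matrix_mul_assoc sq)
qed

text \<open>The eight diagonal matrices with entries 1 or -1. They bound \<open>D2_Z2c\<close> from
  above, so invariance of a test tensor need only be checked on them.\<close>

definition sign_diagonals :: "(real^3^3) set" where
  "sign_diagonals = diag ` {s. \<forall>i. s i * s i = 1}"

lemma generate_sign_diagonals:
  assumes "H \<subseteq> sign_diagonals"
  shows "generate O3 H \<subseteq> sign_diagonals"
proof
  fix Q assume "Q \<in> generate O3 H"
  then show "Q \<in> sign_diagonals"
  proof induction
    case one
    have "mat 1 = diag (\<lambda>i. 1)" by (simp add: diag_one)
    then show ?case by (auto simp: O3_def sign_diagonals_def)
  next
    case (incl h)
    then show ?case using assms by auto
  next
    case (inv h)
    then show ?case using assms by (auto simp: sign_diagonals_def diag_sign_inverse)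
  next
    case (eng h1 h2)
    then obtain s t where st: "h1 = diag s" "h2 = diag t" "\<And>i. s i * s i = 1" "\<And>i. t i * t i = 1"
      by (auto simp: sign_diagonals_def)
    have "s i * t i * (s i * t i) = (s i * s i) * (t i * t i)" for i
      by (simp add: ac_simps)
    then have "(\<lambda>i. s i * t i) \<in> {s. \<forall>i. s i * s i = 1}"
      by (simp add: st)
    then show ?case
      unfolding sign_diagonals_def by (rule image_eqI[rotated]) (simp add: O3_def st diag_mult)
  qed
qed

text \<open>At the angle \<open>pi\<close> Rodrigues' formula becomes -x + 2 (a . x) a, which fixes
  the axis and negates its complement.\<close>

lemma rotation_about_axis_pi:
  "rotation_about (axis k 1) pi = diag (\<lambda>i. if i = k then 1 else - 1)"
  by (simp add: rotation_about_def diag_def matrix_def vec_eq_iff inner_axis_axis) (auto simp: axis_def)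

lemma D2_Z2c_sign_diagonals: "D2_Z2c \<subseteq> sign_diagonals"
proof -
  have "D2 \<subseteq> sign_diagonals"
    unfolding D2_def
    by (intro generate_sign_diagonals) (auto simp: rotation_about_axis_pi sign_diagonals_def)
  moreover have "- mat 1 = diag (\<lambda>i. - 1)"
    by (simp add: diag_def mat_def vec_eq_iff)
  ultimately show ?thesis
    unfolding D2_Z2c_def
    by (intro generate_sign_diagonals) (auto simp: sign_diagonals_def)
qed

lemma half_turns_in_D2_Z2c:
  assumes "k = 1 \<or> k = 3"
  shows "diag (\<lambda>i. if i = k then 1 else - 1) \<in> D2_Z2c"
proof -
  have "rotation_about (axis k 1) pi \<in> D2"
    unfolding D2_def using assms by (intro generate.incl) auto
  then have "rotation_about (axis k 1) pi \<in> D2_Z2c"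
    unfolding D2_Z2c_def by (intro generate.incl UnI1)
  then show ?thesis
    by (simp only: rotation_about_axis_pi)
qed

section \<open>Fourth-order tensors under sign matrices\<close>

lemma transform_diag:
  "(\<Sum>j\<^sub>1\<in>UNIV. \<Sum>j\<^sub>2\<in>UNIV. \<Sum>j\<^sub>3\<in>UNIV. \<Sum>j\<^sub>4\<in>UNIV.
      diag s$i\<^sub>1$j\<^sub>1 * diag s$i\<^sub>2$j\<^sub>2 * diag s$i\<^sub>3$j\<^sub>3 * diag s$i\<^sub>4$j\<^sub>4 * T j\<^sub>1 j\<^sub>2 j\<^sub>3 j\<^sub>4)
    = s i\<^sub>1 * s i\<^sub>2 * s i\<^sub>3 * s i\<^sub>4 * T i\<^sub>1 i\<^sub>2 i\<^sub>3 i\<^sub>4"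
proof -
  have *: "(\<Sum>j\<in>UNIV. c * diag s $ i $ j * f j) = c * s i * f i" for c f i
    by (simp add: diag_def if_distrib[where f="\<lambda>a. _ * a * _"] cong: if_cong)
  \<comment> \<open>The factors 1 on the right give each nested sum the shape that \<open>*\<close>
    collapses to a single term.\<close>
  have "(\<Sum>j\<^sub>1\<in>UNIV. \<Sum>j\<^sub>2\<in>UNIV. \<Sum>j\<^sub>3\<in>UNIV. \<Sum>j\<^sub>4\<in>UNIV.
      diag s$i\<^sub>1$j\<^sub>1 * diag s$i\<^sub>2$j\<^sub>2 * diag s$i\<^sub>3$j\<^sub>3 * diag s$i\<^sub>4$j\<^sub>4 * T j\<^sub>1 j\<^sub>2 j\<^sub>3 j\<^sub>4)
    = (\<Sum>j\<^sub>1\<in>UNIV. 1 * diag s$i\<^sub>1$j\<^sub>1 * (\<Sum>j\<^sub>2\<in>UNIV. 1 * diag s$i\<^sub>2$j\<^sub>2 * (\<Sum>j\<^sub>3\<in>UNIV. 1 * diag s$i\<^sub>3$j\<^sub>3 *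
        (\<Sum>j\<^sub>4\<in>UNIV. 1 * diag s$i\<^sub>4$j\<^sub>4 * T j\<^sub>1 j\<^sub>2 j\<^sub>3 j\<^sub>4))))"
    by (simp add: sum_distrib_left mult.assoc)
  then show ?thesis
    by (simp only: *)
qed

lemma invariant4_diag:
  assumes "invariant4 G T" "diag s \<in> G"
  shows "s i * s j * s l * s m * T i j l m = T i j l m"
  using assms(1)[unfolded invariant4_def, rule_format, OF assms(2), of i j l m]
  unfolding transform_diag .

text \<open>The indices of a nonzero entry pair up, so every sign enters squared. The criterion
  admits the test stiffnesses used for necessity.\<close>

lemma invariant4_D2_Z2c:
  assumes "\<And>i j l m. T i j l m \<noteq> 0 \<Longrightarrow> i = j \<and> l = m \<or> i = l \<and> j = m \<or> i = m \<and> j = l"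
  shows "invariant4 D2_Z2c T"
  unfolding invariant4_def
proof (intro ballI allI)
  fix Q i j l m
  assume "Q \<in> D2_Z2c"
  then obtain s where s: "\<And>i. s i * s i = 1" and Q: "Q = diag s"
    using D2_Z2c_sign_diagonals by (auto simp: sign_diagonals_def)
  have "s i * s j * s l * s m = 1" if "T i j l m \<noteq> 0"
    using assms[OF that]
  proof (elim disjE conjE)
    assume "i = j" "l = m"
    then have "s i * s j * s l * s m = (s i * s i) * (s l * s l)" by simp
    then show ?thesis by (simp add: s)
  next
    assume "i = l" "j = m"
    then have "s i * s j * s l * s m = (s i * s i) * (s j * s j)" by simp
    then show ?thesis by (simp add: s)
  next
    assume "i = m" "j = l"
    then have "s i * s j * s l * s m = (s i * s i) * (s j * s j)" by simp
    then show ?thesis by (simp add: s)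
  qed
  then show "(\<Sum>j\<^sub>1\<in>UNIV. \<Sum>j\<^sub>2\<in>UNIV. \<Sum>j\<^sub>3\<in>UNIV. \<Sum>j\<^sub>4\<in>UNIV.
      Q$i$j\<^sub>1 * Q$j$j\<^sub>2 * Q$l$j\<^sub>3 * Q$m$j\<^sub>4 * T j\<^sub>1 j\<^sub>2 j\<^sub>3 j\<^sub>4) = T i j l m"
    unfolding Q transform_diag by auto
qed

text \<open>The half-turn about an axis \<open>k\<close> other than \<open>i\<close> contributes -1
  from \<open>i\<close> and 1 * (-1) * (-1) = 1 from \<open>j\<close>, \<open>l\<close>,
  \<open>m\<close>, which exhaust the indices. The entry therefore equals its negative.\<close>

lemma invariant4_D2_Z2c_vanish:
  assumes T: "invariant4 D2_Z2c T" and "j \<noteq> l" "j \<noteq> m" "l \<noteq> m"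
  shows "T i j l m = 0"
proof -
  \<comment> \<open>Chosen among 1 and 3 so that the half-turn is one of the two generators.\<close>
  define k :: 3 where "k = (if i = 1 then 3 else 1)"
  then have k: "k = 1 \<or> k = 3" "i \<noteq> k"
    by auto
  let ?s = "\<lambda>i. if i = k then 1 else - 1 :: real"
  have "?s i * ?s j * ?s l * ?s m * T i j l m = T i j l m"
    using invariant4_diag[OF T half_turns_in_D2_Z2c[OF k(1)]] .
  then have "?s i * (?s j * ?s l * ?s m) * T i j l m = T i j l m"
    by (simp only: mult.assoc)
  moreover have "?s j * ?s l * ?s m = 1"
    using assms(2-4) exhaust_3[of j] exhaust_3[of l] exhaust_3[of m] k(1) by auto
  ultimately show ?thesis
    using k(2) by (simp only: if_False)
qed

subsection \<open>Universal displacements\<close>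

lemma pd_const [simp]: "pd j (\<lambda>x. c) x = 0"
  unfolding pd_def by simp

lemma pd_strain:
  assumes "open \<Omega>" "displacement_field \<Omega> u" "x \<in> \<Omega>"
  shows "strain u l m differentiable (at x)"
    and "pd n (strain u l m) x
      = 1/2 * (pd n (pd m (\<lambda>y. u y $ l)) x + pd n (pd l (\<lambda>y. u y $ m)) x)"
proof -
  have diff: "pd a (\<lambda>y. u y $ b) differentiable (at x)" for a b
    using assms unfolding displacement_field_def
    by (intro smooth_on_differentiable[of \<Omega>] smooth_on_pd) auto
  have "(strain u l m has_derivative
      (\<lambda>h. 1/2 * ((\<Sum>j\<in>UNIV. h $ j * pd j (pd m (\<lambda>y. u y $ l)) x)
        + (\<Sum>j\<in>UNIV. h $ j * pd j (pd l (\<lambda>y. u y $ m)) x)))) (at x)"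
    unfolding strain_def
    by (intro has_derivative_mult_right has_derivative_add has_derivative_pd diff)
  note D = this
  show "strain u l m differentiable (at x)"
    using D by (rule differentiableI)
  show "pd n (strain u l m) x
      = 1/2 * (pd n (pd m (\<lambda>y. u y $ l)) x + pd n (pd l (\<lambda>y. u y $ m)) x)"
    using pd_has_derivative[OF D]
    by (simp add: axis_def if_distrib[where f="\<lambda>a. a * _"] cong: if_cong)
qed

lemma pd_stress:
  assumes "open \<Omega>" "displacement_field \<Omega> u" "x \<in> \<Omega>" and M: "\<And>i j k l m. M i j k l m = 0"
  shows "pd j (stress C M u i j) x
    = (\<Sum>l\<in>UNIV. \<Sum>m\<in>UNIV. C i j l m * pd j (strain u l m) x)"
proof -
  \<comment> \<open>One sum over pairs, to fit \<open>pd_linear_combination\<close>.\<close>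
  have "stress C M u i j = (\<lambda>x. \<Sum>k\<in>UNIV. C i j (fst k) (snd k) * strain u (fst k) (snd k) x)"
    by (simp add: stress_def M fun_eq_iff sum.cartesian_product case_prod_unfold)
  then have "pd j (stress C M u i j) x
      = (\<Sum>k\<in>UNIV. C i j (fst k) (snd k) * pd j (strain u (fst k) (snd k)) x)"
    by (simp add: pd_linear_combination pd_strain(1)[OF assms(1-3)])
  then show ?thesis
    by (simp add: sum.cartesian_product case_prod_unfold)
qed

section \<open>Necessity: equations from test stiffnesses\<close>

lemma universal_stiffness:
  assumes u: "universal \<Omega> orthotropic_class u" "open \<Omega>" "displacement_field \<Omega> u" "x \<in> \<Omega>"
    and C: "\<And>i j l m. C i j l m = C j i l m" "\<And>i j l m. C i j l m = C l m i j"
      "\<And>i j l m. C i j l m \<noteq> 0 \<Longrightarrow> i = j \<and> l = m \<or> i = l \<and> j = m \<or> i = m \<and> j = l"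
  shows "(\<Sum>j\<in>UNIV. \<Sum>l\<in>UNIV. \<Sum>m\<in>UNIV. C i j l m * pd j (strain u l m) x) = 0"
proof -
  let ?M = "\<lambda>i j k l m. 0" and ?A = "\<lambda>i j k l m n. 0"
  have "sg_material C ?M ?A"
    using C(1,2) unfolding sg_material_def by blast
  moreover have "invariant6 D2_Z2c ?A"
    by (simp add: invariant6_def)
  ultimately have "(C, ?M, ?A) \<in> orthotropic_class"
    using invariant4_D2_Z2c[of C] C(3) by (simp add: orthotropic_class_def)
  then have "equilibrium \<Omega> C ?M ?A u"
    using u(1) by (auto simp: universal_def)
  moreover have "hyperstress ?M ?A u i j k = (\<lambda>x. 0)" for i j k
    by (simp add: hyperstress_def fun_eq_iff)
  moreover have "pd j (\<lambda>x. 0) = (\<lambda>x. 0)" for j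
    by (simp add: fun_eq_iff)
  ultimately have "(\<Sum>j\<in>UNIV. pd j (stress C ?M u i j) x) = 0"
    using u(4) by (simp add: equilibrium_def)
  then show ?thesis
    using u(2-4) by (simp add: pd_stress)
qed

lemma universal_second_derivatives:
  assumes u: "universal \<Omega> orthotropic_class u" "open \<Omega>" "displacement_field \<Omega> u" "x \<in> \<Omega>"
  shows "pd p (pd q (\<lambda>y. u y $ q)) x = 0"
    and "pd q (pd q (\<lambda>y. u y $ p)) x = 0"
proof -
  have "pd p (strain u q q) x = 0" for p q
  proof -
    \<comment> \<open>Unit entries at ppqq and qqpp, as the major symmetry demands. In equation
      \<open>p\<close> only j = p, l = m = q survives.\<close>
    let ?C = "\<lambda>i j l m. of_bool (i = j \<and> l = m \<and> (i = p \<and> l = q \<or> i = q \<and> l = p))"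
    have "(\<Sum>j\<in>UNIV. \<Sum>l\<in>UNIV. \<Sum>m\<in>UNIV. ?C p j l m * pd j (strain u l m) x) = 0"
      using u by (rule universal_stiffness) (simp_all only: of_bool_eq_0_iff of_bool_eq_iff, blast+)
    then show ?thesis
      using exhaust_3[of p] exhaust_3[of q] by (elim disjE; simp add: sum_3)
  qed
  then show *: "pd p (pd q (\<lambda>y. u y $ q)) x = 0" for p q
    using pd_strain(2)[OF u(2-4)] by simp
  show "pd q (pd q (\<lambda>y. u y $ p)) x = 0"
  proof (cases "p = q")
    case False
    \<comment> \<open>The shear stiffness for the pair p, q with all its symmetric copies. Equation
      \<open>p\<close> then reads u_{p,qq} + u_{q,pq} = 0, and the second term is known to
      vanish.\<close>
    let ?C = "\<lambda>i j l m. of_bool ((i = p \<and> j = q \<or> i = q \<and> j = p) \<and> (l = p \<and> m = q \<or> l = q \<and> m = p))"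
    have "(\<Sum>j\<in>UNIV. \<Sum>l\<in>UNIV. \<Sum>m\<in>UNIV. ?C p j l m * pd j (strain u l m) x) = 0"
      using u by (rule universal_stiffness) (simp_all only: of_bool_eq_0_iff of_bool_eq_iff, blast+)
    then have "pd q (strain u p q) x + pd q (strain u q p) x = 0"
      using False exhaust_3[of p] exhaust_3[of q] by (elim disjE; simp add: sum_3)
    moreover have "pd q (pd p (\<lambda>y. u y $ q)) x = 0"
      using * pd_commute[OF u(2,4)] u(3) by (auto simp: displacement_field_def)
    ultimately show ?thesis
      using pd_strain(2)[OF u(2-4)] by simp
  qed (use * in simp)
qed

section \<open>Integration of the second-derivative equations\<close>

text \<open>The surviving mixed derivative has zero gradient, so it is a constant \<alpha>. Removing
  \<alpha> x_q x_r leaves a constant gradient, hence an affine function.\<close>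

lemma bilinear_form:
  assumes \<Omega>: "open \<Omega>" "convex \<Omega>" and f: "smooth_on \<Omega> f"
    and pqr: "UNIV = {p, q, r}" "p \<noteq> q" "p \<noteq> r" "q \<noteq> r"
    and vanish: "\<And>a b x. x \<in> \<Omega> \<Longrightarrow> {a, b} \<noteq> {q, r} \<Longrightarrow> pd a (pd b f) x = 0"
  shows "\<exists>d c \<alpha>. \<forall>x\<in>\<Omega>. f x = d + (\<Sum>j\<in>UNIV. c j * x $ j) + \<alpha> * x $ q * x $ r"
proof -
  have comm: "pd a (pd b (pd c f)) x = pd b (pd a (pd c f)) x" if "x \<in> \<Omega>" for a b c x
    using \<Omega>(1) that f by (intro pd_commute smooth_on_pd)
  have zero: "pd a (pd b (pd c f)) x = 0" if "x \<in> \<Omega>" "{b, c} \<noteq> {q, r}" for a b c x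
    using pd_cong[OF \<Omega>(1) that(1), of "pd b (pd c f)" "\<lambda>x. 0"] vanish that(2) by simp
  have third: "pd a (pd r (pd q f)) x = 0" if x: "x \<in> \<Omega>" for a x
  proof -
    consider "a = p" | "a = q" | "a = r"
      using pqr(1) by blast
    then show ?thesis
    proof cases
      \<comment> \<open>The repeated \<open>r\<close> must become the inner pair: first the inner
        two derivatives are swapped under \<open>pd r\<close>, then the outer two. The other cases
        need only the outer swap.\<close>
      case 3
      have "pd r (pd r (pd q f)) x = pd r (pd q (pd r f)) x"
        by (intro pd_cong[OF \<Omega>(1) x] pd_commute[OF \<Omega>(1) _ f])
      also have "\<dots> = pd q (pd r (pd r f)) x"
        using x by (rule comm)
      finally show ?thesis
        using 3 zero[OF x] pqr by simp
    qed (use comm[OF x] zero[OF x] pqr in \<open>auto simp: doubleton_eq_iff\<close>)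
  qed
  have diff: "pd a f differentiable_on \<Omega>" "pd a (pd b f) differentiable_on \<Omega>" for a b
    using f by (intro smooth_on_imp_differentiable_on smooth_on_pd; assumption)+
  obtain \<alpha> where \<alpha>: "pd r (pd q f) x = \<alpha>" if "x \<in> \<Omega>" for x
    using affine_if_pd_constant[OF \<Omega> diff(2), of r q "\<lambda>j. 0"] third by auto
  have \<alpha>': "pd q (pd r f) x = \<alpha>" if "x \<in> \<Omega>" for x
    using \<alpha>[OF that] pd_commute[OF \<Omega>(1) that f] by simp
  obtain cp where cp: "pd p f x = cp" if "x \<in> \<Omega>" for x
    using affine_if_pd_constant[OF \<Omega> diff(1), of p "\<lambda>j. 0"] vanish pqr by (auto simp: doubleton_eq_iff)
  have "pd j (pd q f) x = (if j = r then \<alpha> else 0)" if "x \<in> \<Omega>" for j x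
    using \<alpha> vanish that pqr by (auto simp: doubleton_eq_iff)
  from affine_if_pd_constant[OF \<Omega> diff(1) this]
  obtain cq where cq: "pd q f x = cq + \<alpha> * x $ r" if "x \<in> \<Omega>" for x
    by (auto simp: if_distrib[where f="\<lambda>a. a * _"] cong: if_cong)
  have "pd j (pd r f) x = (if j = q then \<alpha> else 0)" if "x \<in> \<Omega>" for j x
    using \<alpha>' vanish that pqr by (auto simp: doubleton_eq_iff)
  from affine_if_pd_constant[OF \<Omega> diff(1) this]
  obtain cr where cr: "pd r f x = cr + \<alpha> * x $ q" if "x \<in> \<Omega>" for x
    by (auto simp: if_distrib[where f="\<lambda>a. a * _"] cong: if_cong)
  define c where "c j = (if j = p then cp else if j = q then cq else cr)" for j
  \<comment> \<open>Its gradient is \<open>c\<close>: the terms \<alpha> x_r in \<open>cq\<close>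
    and \<alpha> x_q in \<open>cr\<close> cancel.\<close>
  let ?g = "\<lambda>x. f x - \<alpha> * x $ q * x $ r"
  have g: "(?g has_derivative (\<lambda>h. (\<Sum>j\<in>UNIV. h $ j * pd j f x)
      - (\<alpha> * x $ q * h $ r + \<alpha> * h $ q * x $ r))) (at x)" if "x \<in> \<Omega>" for x
    using smooth_on_differentiable[OF f \<Omega>(1) that]
    by (intro has_derivative_diff has_derivative_pd has_derivative_mult has_derivative_mult_right
        bounded_linear_imp_has_derivative bounded_linear_vec_nth)
  have pd_g: "pd j ?g x = c j" if "x \<in> \<Omega>" for j x
  proof -
    have "pd j ?g x = pd j f x - (\<alpha> * x $ q * axis j 1 $ r + \<alpha> * axis j 1 $ q * x $ r)"
      using pd_has_derivative[OF g[OF that]]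
      by (simp add: axis_def if_distrib[where f="\<lambda>a. a * _"] cong: if_cong)
    moreover have "j = p \<or> j = q \<or> j = r"
      using pqr(1) by blast
    ultimately show ?thesis
      using pqr(2-4) cp[OF that] cq[OF that] cr[OF that] by (auto simp: axis_def c_def)
  qed
  have "?g differentiable_on \<Omega>"
    using g \<Omega>(1) by (auto simp: differentiable_on_eq_differentiable_at differentiable_def)
  from affine_if_pd_constant[OF \<Omega> this pd_g]
  obtain d where d: "?g x = d + (\<Sum>j\<in>UNIV. c j * x $ j)" if "x \<in> \<Omega>" for x
    by blast
  then have "\<forall>x\<in>\<Omega>. f x = d + (\<Sum>j\<in>UNIV. c j * x $ j) + \<alpha> * x $ q * x $ r"
    by (simp add: diff_eq_eq)
  then show ?thesis
    by (intro exI)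
qed

text \<open>Second derivatives for the converse. As \<open>f\<close> is known only on \<Omega>, its
  formula and that of its first derivative are both transferred by \<open>pd_cong\<close>.\<close>

lemma pd_pd_bilinear:
  assumes "open \<Omega>" "x \<in> \<Omega>" "q \<noteq> r"
    and f: "\<And>x. x \<in> \<Omega> \<Longrightarrow> f x = d + (\<Sum>j\<in>UNIV. c j * x $ j) + \<alpha> * x $ q * x $ r"
  shows "pd a (pd b f) x = (if {a, b} = {q, r} then \<alpha> else 0)"
proof -
  have "((\<lambda>x. d + (\<Sum>j\<in>UNIV. c j * x $ j) + \<alpha> * x $ q * x $ r) has_derivative
     (\<lambda>h. 0 + (\<Sum>j\<in>UNIV. c j * h $ j) + (\<alpha> * y $ q * h $ r + \<alpha> * h $ q * y $ r))) (at y)" for y :: "real^3"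
    by (intro has_derivative_add has_derivative_const has_derivative_sum has_derivative_mult
        has_derivative_mult_right bounded_linear_imp_has_derivative bounded_linear_vec_nth)
  from pd_has_derivative[OF this]
  have "pd b f y = c b + (\<alpha> * axis b 1 $ r * y $ q + \<alpha> * axis b 1 $ q * y $ r)" if "y \<in> \<Omega>" for y
    using pd_cong[OF assms(1) that f]
    by (simp add: axis_def if_distrib[where f="\<lambda>a. _ * a"] cong: if_cong)
  from pd_cong[OF assms(1,2) this]
  have "pd a (pd b f) x = pd a (\<lambda>y. c b + (\<alpha> * axis b 1 $ r * y $ q + \<alpha> * axis b 1 $ q * y $ r)) x" .
  also have "\<dots> = 0 + (\<alpha> * axis b 1 $ r * axis a 1 $ q + \<alpha> * axis b 1 $ q * axis a 1 $ r)"
    by (intro pd_has_derivative has_derivative_add has_derivative_const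
        has_derivative_mult_right bounded_linear_imp_has_derivative bounded_linear_vec_nth)
  finally show ?thesis
    using assms(3) by (auto simp: axis_def doubleton_eq_iff)
qed

lemma shift_3: "UNIV = {i, i + 1, i + 2}" "i \<noteq> i + 1" "i \<noteq> i + 2" "i + 1 \<noteq> i + 2" for i :: 3
proof -
  show "i \<noteq> i + 1" by simp
  show "i \<noteq> i + 2" by simp
  show "i + 1 \<noteq> i + 2" by simp
  consider "i = 1" | "i = 2" | "i = 3"
    using exhaust_3[of i] by blast
  then show "UNIV = {i, i + 1, i + 2}"
  proof cases
    case 1
    then show ?thesis by (simp add: UNIV_3)
  next
    case 2
    then show ?thesis unfolding UNIV_3 by auto
  next
    case 3
    then show ?thesis unfolding UNIV_3 by auto
  qed
qed

text \<open>These sums arise from \<open>i + 1\<close> and \<open>i + 2\<close> when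
  \<open>i\<close> is 2 or 3.\<close>

lemma numerals_3: "(4::3) = 1" "(5::3) = 2"
  by simp_all

text \<open>Addition on type \<^typ>\<open>3\<close> is modulo 3, so \<open>i + 1\<close> and \<open>i + 2\<close> are the two indices other than \<open>i\<close>.\<close>

definition bilinear_field ::
  "(real^3) set \<Rightarrow> (real^3 \<Rightarrow> real^3) \<Rightarrow> (3 \<Rightarrow> 3 \<Rightarrow> real) \<Rightarrow> (3 \<Rightarrow> real) \<Rightarrow> (3 \<Rightarrow> real) \<Rightarrow> bool" where
  "bilinear_field \<Omega> u H b \<alpha> \<longleftrightarrow>
    (\<forall>x\<in>\<Omega>. \<forall>i. u x $ i = b i + (\<Sum>j\<in>UNIV. H i j * x $ j) + \<alpha> i * x $ (i + 1) * x $ (i + 2))"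

lemma universal_imp_bilinear_field:
  assumes \<Omega>: "open \<Omega>" "convex \<Omega>" and u: "displacement_field \<Omega> u" "universal \<Omega> orthotropic_class u"
  shows "\<exists>H b \<alpha>. bilinear_field \<Omega> u H b \<alpha>"
proof -
  have "\<forall>i. \<exists>d c \<alpha>. \<forall>x\<in>\<Omega>. u x $ i = d + (\<Sum>j\<in>UNIV. c j * x $ j) + \<alpha> * x $ (i + 1) * x $ (i + 2)"
    (is "\<forall>i. ?P i")
  proof
    fix i
    have smooth: "smooth_on \<Omega> (\<lambda>y. u y $ i)"
      using u(1) by (simp add: displacement_field_def)
    note zero = universal_second_derivatives[OF u(2) \<Omega>(1) u(1)]
    have "pd a (pd b (\<lambda>y. u y $ i)) x = 0" if x: "x \<in> \<Omega>" and ab: "{a, b} \<noteq> {i + 1, i + 2}" for a b x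
    proof -
      have "a \<in> {i, i + 1, i + 2}" "b \<in> {i, i + 1, i + 2}"
        using shift_3(1)[of i] by auto
      \<comment> \<open>The derivatives are then of the types u_{i,ib}, u_{i,ai} and u_{i,aa}, all
        known to vanish; the first needs its order exchanged.\<close>
      then consider "a = i" | "b = i" | "a = b"
        using ab by auto
      then show ?thesis
        using zero[OF x] pd_commute[OF \<Omega>(1) x smooth] by cases auto
    qed
    then show "?P i"
      by (rule bilinear_form[OF \<Omega> smooth shift_3(1-4)])
  qed
  then have "\<exists>b H \<alpha>. \<forall>i. \<forall>x\<in>\<Omega>.
      u x $ i = b i + (\<Sum>j\<in>UNIV. H i j * x $ j) + \<alpha> i * x $ (i + 1) * x $ (i + 2)"
    by (simp only: choice_iff)
  then obtain b H \<alpha> where "\<forall>i. \<forall>x\<in>\<Omega>.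
      u x $ i = b i + (\<Sum>j\<in>UNIV. H i j * x $ j) + \<alpha> i * x $ (i + 1) * x $ (i + 2)"
    by (elim exE) (rule that)
  then have "bilinear_field \<Omega> u H b \<alpha>"
    by (simp add: bilinear_field_def)
  then show ?thesis
    by (intro exI)
qed

section \<open>Sufficiency: constant strain gradients\<close>

lemma bilinear_field_strain_gradient:
  assumes "open \<Omega>" "displacement_field \<Omega> u" "bilinear_field \<Omega> u H b \<alpha>"
  obtains E where "\<And>l m n x. x \<in> \<Omega> \<Longrightarrow> pd n (strain u l m) x = E l m n"
    and "\<And>l m n. E l m n \<noteq> 0 \<Longrightarrow> l \<noteq> m \<and> l \<noteq> n \<and> m \<noteq> n"
proof -
  \<comment> \<open>The values of u_{l,mn}. Distinctness of the indices survives exchanging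
    \<open>l\<close> and \<open>m\<close>, hence symmetrization to the strain.\<close>
  define K where "K l m n = (if {n, m} = {l + 1, l + 2} then \<alpha> l else 0)" for l m n
  have K: "pd n (pd m (\<lambda>y. u y $ l)) x = K l m n" if "x \<in> \<Omega>" for l m n x
    unfolding K_def using assms(3)
    by (intro pd_pd_bilinear[OF assms(1) that shift_3(4)]) (auto simp: bilinear_field_def)
  have distinct: "l \<noteq> m \<and> l \<noteq> n \<and> m \<noteq> n" if "K l m n \<noteq> 0" for l m n
    using that shift_3(2-4)[of l] by (auto simp: K_def doubleton_eq_iff split: if_splits)
  show thesis
  proof
    show "pd n (strain u l m) x = 1/2 * (K l m n + K m l n)" if "x \<in> \<Omega>" for l m n x
      using pd_strain(2)[OF assms(1,2) that] K[OF that] by simp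
    show "l \<noteq> m \<and> l \<noteq> n \<and> m \<noteq> n" if "1/2 * (K l m n + K m l n) \<noteq> 0" for l m n
    proof -
      have "K l m n \<noteq> 0 \<or> K m l n \<noteq> 0" using that by auto
      then show ?thesis using distinct by blast
    qed
  qed
qed

lemma bilinear_field_imp_universal:
  assumes \<Omega>: "open \<Omega>" and u: "displacement_field \<Omega> u" "bilinear_field \<Omega> u H b \<alpha>"
  shows "universal \<Omega> orthotropic_class u"
  unfolding universal_def
proof clarify
  fix C M A assume "(C, M, A) \<in> orthotropic_class"
  then have C: "invariant4 D2_Z2c C" and M: "\<And>i j k l m. M i j k l m = 0"
    by (auto simp: orthotropic_class_def)
  obtain E where E: "\<And>l m n x. x \<in> \<Omega> \<Longrightarrow> pd n (strain u l m) x = E l m n"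
    and distinct: "\<And>l m n. E l m n \<noteq> 0 \<Longrightarrow> l \<noteq> m \<and> l \<noteq> n \<and> m \<noteq> n"
    using bilinear_field_strain_gradient[OF \<Omega> u] by blast
  show "equilibrium \<Omega> C M A u"
    unfolding equilibrium_def
  proof (intro ballI allI)
    fix x i assume x: "x \<in> \<Omega>"
    \<comment> \<open>If \<open>j\<close>, \<open>l\<close>, \<open>m\<close> are distinct the
      stiffness vanishes, otherwise the strain gradient does.\<close>
    have "C i j l m * E l m j = 0" for j l m
      using invariant4_D2_Z2c_vanish[OF C, of j l m i] distinct[of l m j] by auto
    then have stress: "pd j (stress C M u i j) x = 0" for j
      by (simp only: pd_stress[OF \<Omega> u(1) x M] E[OF x]) simp
    have "hyperstress M A u i j k y = (\<Sum>l\<in>UNIV. \<Sum>m\<in>UNIV. \<Sum>n\<in>UNIV. A i j k l m n * E l m n)"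
      if "y \<in> \<Omega>" for j k y
      by (simp add: hyperstress_def M E[OF that])
    \<comment> \<open>The hyper-stress is constant on \<Omega>, whatever \<open>A\<close> is.
      Vanishing at all points of \<Omega> is kept for the second differentiation.\<close>
    from pd_cong[OF \<Omega> _ this] have "pd j (hyperstress M A u i j k) y = 0" if "y \<in> \<Omega>" for j k y
      using that by simp
    from pd_cong[OF \<Omega> x this] have "pd k (pd j (hyperstress M A u i j k)) x = 0" for j k
      by simp
    then show "(\<Sum>j\<in>UNIV. pd j (stress C M u i j) x)
        - (\<Sum>j\<in>UNIV. \<Sum>k\<in>UNIV. pd k (pd j (hyperstress M A u i j k)) x) = 0"
      by (simp add: stress)
  qed
qed

theorem proposition3p8:
  fixes \<Omega> :: "(real^3) set" and u :: "real^3 \<Rightarrow> real^3"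
  assumes "open \<Omega>" and "convex \<Omega>" and "\<Omega> \<noteq> {}"
    and "displacement_field \<Omega> u"
  shows "universal \<Omega> orthotropic_class u \<longleftrightarrow>
    (\<exists>v \<alpha>\<^sub>1 \<alpha>\<^sub>2 \<alpha>\<^sub>3. homogeneous \<Omega> v \<and>
       (\<forall>x\<in>\<Omega>. u x = v x + vector [\<alpha>\<^sub>1 * x$2 * x$3, \<alpha>\<^sub>2 * x$1 * x$3, \<alpha>\<^sub>3 * x$1 * x$2]))"
proof
  assume "universal \<Omega> orthotropic_class u"
  then obtain H b \<alpha> where u: "bilinear_field \<Omega> u H b \<alpha>"
    using universal_imp_bilinear_field[OF assms(1,2,4)] by blast
  let ?v = "\<lambda>x. (\<chi> i j. H i j) *v x + (\<chi> i. b i)"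
  have "homogeneous \<Omega> ?v"
    unfolding homogeneous_def by blast
  moreover have "u x = ?v x + vector [\<alpha> 1 * x$2 * x$3, \<alpha> 2 * x$1 * x$3, \<alpha> 3 * x$1 * x$2]"
    if "x \<in> \<Omega>" for x
    using u that by (simp add: bilinear_field_def vec_eq_iff forall_3 numerals_3 matrix_vector_mult_def ac_simps)
  ultimately show "\<exists>v \<alpha>\<^sub>1 \<alpha>\<^sub>2 \<alpha>\<^sub>3. homogeneous \<Omega> v \<and>
      (\<forall>x\<in>\<Omega>. u x = v x + vector [\<alpha>\<^sub>1 * x$2 * x$3, \<alpha>\<^sub>2 * x$1 * x$3, \<alpha>\<^sub>3 * x$1 * x$2])"
    by blast
next
  assume "\<exists>v \<alpha>\<^sub>1 \<alpha>\<^sub>2 \<alpha>\<^sub>3. homogeneous \<Omega> v \<and>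
      (\<forall>x\<in>\<Omega>. u x = v x + vector [\<alpha>\<^sub>1 * x$2 * x$3, \<alpha>\<^sub>2 * x$1 * x$3, \<alpha>\<^sub>3 * x$1 * x$2])"
  then obtain H :: "real^3^3" and b \<alpha>\<^sub>1 \<alpha>\<^sub>2 \<alpha>\<^sub>3 where u: "\<And>x. x \<in> \<Omega> \<Longrightarrow>
      u x = H *v x + b + vector [\<alpha>\<^sub>1 * x$2 * x$3, \<alpha>\<^sub>2 * x$1 * x$3, \<alpha>\<^sub>3 * x$1 * x$2]"
    unfolding homogeneous_def by auto
  \<comment> \<open>The cyclic products x_{i+1} x_{i+2} are x_2 x_3, x_3 x_1, x_1 x_2, so the
    coefficients keep their order.\<close>
  define \<alpha> where "\<alpha> = (\<lambda>i :: 3. if i = 1 then \<alpha>\<^sub>1 else if i = 2 then \<alpha>\<^sub>2 else \<alpha>\<^sub>3)"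
  have "bilinear_field \<Omega> u (\<lambda>i j. H $ i $ j) (\<lambda>i. b $ i) \<alpha>"
    unfolding bilinear_field_def by (simp add: u forall_3 numerals_3 matrix_vector_mult_def \<alpha>_def ac_simps)
  then show "universal \<Omega> orthotropic_class u"
    using bilinear_field_imp_universal assms(1,4) by blast
qed

end
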